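(* Let $\{Y_t\}_{t\ge1}$ be an $\mathbb{R}^p$-valued process, let $\theta\in\mathbb{R}^p$, and put $\theta_n=n^{-1}\sum_{t=1}^nY_t$. Suppose the strong invariance principle holds: there exist a $p\times p$ lower triangular matrix $L$, a nonnegative increasing function $\gamma$ on the positive integers, a finite random variable $D$, and a sufficiently rich probability space carrying the process and a $p$-dimensional standard Brownian motion $\{B(t),t\ge0\}$ such that, with probability 1, for all sufficiently large $n$, $$\|n(\theta_n-\theta)-LB(n)\|<D\,\gamma(n).$$ Set $\Sigma=LL^T$. Suppose the batch sizes $b_n$ satisfy the batch size condition (defined in the context). If $b_n^{-1/2}(\log n)^{1/2}\gamma(n)\to0$ as $n\to\infty$, then the multivariate batch means estimator $\Sigma_n$ (defined in the context) satisfies $\Sigma_n\to\Sigma$ with probability 1 as $n\to\infty$.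
   Context: $\|\cdot\|$ is the Euclidean norm. Batch size condition: (1) $b_n$ is an integer sequence with $b_n\to\infty$ and $n/b_n\to\infty$ as $n\to\infty$, where $b_n$ and $n/b_n$ are monotonically increasing up to integer rounding, meaning $b_n=\lfloor\beta_n\rfloor$ for a real sequence $\beta_n\ge1$ such that $\beta_n$ and $n/\beta_n$ are nondecreasing (e.g. $b_n=\lfloor n^\nu\rfloor$, $0<\nu<1$); (2) there is a constant $c\ge1$ such that $\sum_n(b_n/n)^c<\infty$. Multivariate batch means estimator: with $a_n=\lfloor n/b_n\rfloor$ the number of batches and $\bar Y_k=b_n^{-1}\sum_{t=1}^{b_n}Y_{kb_n+t}$ for $k=0,\dots,a_n-1$, $$\Sigma_n=\frac{b_n}{a_n-1}\sum_{k=0}^{a_n-1}(\bar Y_k-\theta_n)(\bar Y_k-\theta_n)^T$$ (defined once $a_n\ge2$). *)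

theory Defs
  imports "HOL-Probability.Probability"
begin

text \<open>
  Coordinates are indexed by a finite linearly ordered type \<open>'p\<close>, with \<open>p = CARD('p)\<close>; the order is
  only used to speak of triangular matrices.
\<close>

definition lower_triangular :: "real^'p::{finite,linorder}^'p::{finite,linorder} \<Rightarrow> bool" where
  "lower_triangular L \<longleftrightarrow> (\<forall>i j. i < j \<longrightarrow> L $ i $ j = 0)"

text \<open>
  Processes are indexed by \<open>t \<ge> 1\<close>; the value at \<open>t = 0\<close> is never used, so it is excluded from the law.
\<close>

definition process_law :: "'a measure \<Rightarrow> (nat \<Rightarrow> 'a \<Rightarrow> real^'p) \<Rightarrow> (nat \<Rightarrow> real^'p) measure" where
  "process_law M Y = distr M (\<Pi>\<^sub>M t\<in>{1..}. borel) (\<lambda>\<omega>. \<lambda>t\<in>{1..}. Y t \<omega>)"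

text \<open>
  The density below is that of the centred normal distribution on \<open>real^'p\<close> with covariance matrix
  \<open>(t - s)\<close> times the identity; \<open>normal_density\<close> takes the standard deviation as its second argument.
\<close>

definition standard_brownian_motion :: "'b measure \<Rightarrow> (real \<Rightarrow> 'b \<Rightarrow> real^'p) \<Rightarrow> bool" where
  "standard_brownian_motion N B \<longleftrightarrow>
     prob_space N \<and>
     (\<forall>t\<ge>0. B t \<in> borel_measurable N) \<and>
     (AE \<omega> in N. B 0 \<omega> = 0) \<and>
     (\<forall>k (t :: nat \<Rightarrow> real). 0 \<le> t 0 \<and> (\<forall>i<k. t i < t (Suc i)) \<longrightarrow>
        prob_space.indep_vars N (\<lambda>_. borel) (\<lambda>i \<omega>. B (t (Suc i)) \<omega> - B (t i) \<omega>) {..<k}) \<and>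
     (\<forall>s t. 0 \<le> s \<and> s < t \<longrightarrow>
        distributed N lborel (\<lambda>\<omega>. B t \<omega> - B s \<omega>)
          (\<lambda>x. ennreal (\<Prod>i\<in>UNIV. normal_density 0 (sqrt (t - s)) (x $ i)))) \<and>
     (AE \<omega> in N. continuous_on {0..} (\<lambda>t. B t \<omega>))"

text \<open>
  In the last conjunct the term \<open>n = 0\<close> is \<open>0\<close>, because \<open>x / 0 = 0\<close> and \<open>0 powr c = 0\<close>.
\<close>

definition batch_size_condition :: "(nat \<Rightarrow> nat) \<Rightarrow> bool" where
  "batch_size_condition b \<longleftrightarrow>
     filterlim b at_top sequentially \<and>
     filterlim (\<lambda>n. real n / real (b n)) at_top sequentially \<and>
     (\<exists>\<beta> :: nat \<Rightarrow> real.
        (\<forall>n\<ge>1. \<beta> n \<ge> 1 \<and> int (b n) = \<lfloor>\<beta> n\<rfloor>) \<and>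
        mono_on {1..} \<beta> \<and>
        mono_on {1..} (\<lambda>n. real n / \<beta> n)) \<and>
     (\<exists>c\<ge>1. summable (\<lambda>n. (real (b n) / real n) powr c))"

definition sample_mean :: "(nat \<Rightarrow> real^'p) \<Rightarrow> nat \<Rightarrow> real^'p" where
  "sample_mean y n = (1 / real n) *\<^sub>R (\<Sum>t=1..n. y t)"

definition batch_mean :: "(nat \<Rightarrow> real^'p) \<Rightarrow> nat \<Rightarrow> nat \<Rightarrow> real^'p" where
  "batch_mean y m k = (1 / real m) *\<^sub>R (\<Sum>t=1..m. y (k * m + t))"

text \<open>
  The estimator is a function of a single trajectory \<open>y\<close>. The product of a column and a row vector
  is the outer product, once the dimension between them is fixed to \<open>1\<close> by the type
  annotation. For fewer than two batches the value is meaningless.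
\<close>

definition batch_means_estimator :: "(nat \<Rightarrow> nat) \<Rightarrow> (nat \<Rightarrow> real^'p) \<Rightarrow> nat \<Rightarrow> real^'p^'p" where
  "batch_means_estimator b y n =
     (let a = n div b n in
      (real (b n) / (real a - 1)) *\<^sub>R
        (\<Sum>k<a. columnvector (batch_mean y (b n) k - sample_mean y n) **
                (rowvector (batch_mean y (b n) k - sample_mean y n) :: real^'p^1)))"

end

theory Submission
  imports Defs "HOL-Real_Asymp.Real_Asymp"
begin

text \<open>
  Up to an error controlled by \<open>\<gamma> n / sqrt (b n)\<close>, the strong invariance principle turns
  \<open>sqrt (b n)\<close> times the centred mean of batch \<open>k\<close> into \<open>L *v Z\<^sub>k\<close>, where the
  \<open>Z\<^sub>k\<close> are the Brownian increments over the batches, normalised to independent standard normal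
  vectors; the error vanishes, and so does \<open>sqrt (b n)\<close> times the deviation of the overall mean.
  It remains to see that the averages of \<open>Z\<^sub>k $ i * Z\<^sub>k $ j\<close> over the \<open>n div b n\<close>
  batches converge almost surely to \<open>1\<close> if \<open>i = j\<close> and to \<open>0\<close> otherwise. By
  Chernoff's method their deviation probabilities decay exponentially in \<open>n / b n\<close>, which is
  summable by the second part of the batch size condition, so Borel--Cantelli applies. Finally,
  almost sure convergence of the estimator depends only on the law of the process.
\<close>

section \<open>Exponential tail bounds\<close>

text \<open>Taylor's formula with Lagrange remainder: the intermediate point lies within
  \<open>\<bar>u\<bar> \<le> v\<close> of zero, so \<open>exp v\<close> bounds the remainder's
  exponential.\<close>

lemma exp_le_quadratic:
  fixes u v :: real
  assumes "\<bar>u\<bar> \<le> v"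
  shows "exp u \<le> 1 + u + u\<^sup>2 / 2 * exp v"
proof -
  obtain t where t: "\<bar>t\<bar> \<le> \<bar>u\<bar>" "exp u = (\<Sum>m<2. u ^ m / fact m) + exp t / fact 2 * u ^ 2"
    using Maclaurin_exp_le[of u 2] by auto
  have "exp t \<le> exp v" using t(1) assms by simp
  then have "u\<^sup>2 / 2 * exp t \<le> u\<^sup>2 / 2 * exp v" by (intro mult_left_mono) auto
  then show ?thesis using t(2) by (simp add: numeral_2_eq_2 algebra_simps)
qed

text \<open>Mean zero removes the linear term of the exponential, so the logarithm of the moment
  generating function is at most quadratic in \<open>l\<close>. Keeping \<open>\<bar>l\<bar>\<close>
  below \<open>\<tau> / 2\<close> leaves half of the available exponential weight to absorb the
  factor \<open>(l * x)\<^sup>2\<close>.\<close>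

lemma (in prob_space) exp_moment_le:
  fixes X :: "'a \<Rightarrow> real"
  assumes [measurable]: "X \<in> borel_measurable M"
    and mean: "expectation X = 0" and \<tau>: "\<tau> > 0" and K: "K \<ge> 0"
    and exp_moment: "(\<integral>\<^sup>+x. ennreal (exp (\<tau> * \<bar>X x\<bar>)) \<partial>M) \<le> ennreal K"
    and l: "\<bar>l\<bar> \<le> \<tau> / 2"
  shows "(\<integral>\<^sup>+x. ennreal (exp (l * X x)) \<partial>M) \<le> ennreal (exp (4 * l\<^sup>2 * K / \<tau>\<^sup>2))"
proof -
  let ?G = "\<lambda>x. exp (\<tau> * \<bar>X x\<bar>)"
  have fin: "(\<integral>\<^sup>+x. ennreal (?G x) \<partial>M) < \<infinity>"
    using exp_moment by (rule order.strict_trans1) simp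
  then have G: "integrable M ?G"
    by (intro integrableI_nonneg) auto
  then have GK: "expectation ?G \<le> K"
    using exp_moment K by (simp add: nn_integral_eq_integral)
  have "\<bar>x\<bar> \<le> exp (\<tau> * \<bar>x\<bar>) / \<tau>" for x
  proof -
    have "\<tau> * \<bar>x\<bar> \<le> exp (\<tau> * \<bar>x\<bar>)" using exp_ge_add_one_self[of "\<tau> * \<bar>x\<bar>"] by linarith
    then show ?thesis using \<tau> by (simp add: field_simps)
  qed
  then have X: "integrable M X"
    using \<tau> by (intro Bochner_Integration.integrable_bound[OF integrable_divide[OF G, of \<tau>]]) auto
  \<comment> \<open>In terms of \<open>?y\<close>, half of \<open>\<tau> * \<bar>x\<bar>\<close>,
    the remainder is \<open>4 * l\<^sup>2 / \<tau>\<^sup>2\<close> times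
    \<open>?y\<^sup>2 / 2 * exp ?y\<close>; bounding \<open>?y\<^sup>2 / 2\<close> by
    \<open>exp ?y\<close> makes up the full weight
    \<open>exp (\<tau> * \<bar>x\<bar>)\<close>.\<close>
  have pt: "exp (l * x) \<le> 1 + l * x + 4 * l\<^sup>2 / \<tau>\<^sup>2 * exp (\<tau> * \<bar>x\<bar>)" for x
  proof -
    let ?y = "\<tau> * \<bar>x\<bar> / 2"
    have y: "?y \<ge> 0" using \<tau> by simp
    have "\<bar>l * x\<bar> \<le> ?y" using mult_right_mono[OF l, of "\<bar>x\<bar>"] by (simp add: abs_mult)
    then have "exp (l * x) \<le> 1 + l * x + (l * x)\<^sup>2 / 2 * exp ?y" by (rule exp_le_quadratic)
    moreover have "(l * x)\<^sup>2 / 2 * exp ?y = 4 * l\<^sup>2 / \<tau>\<^sup>2 * (?y\<^sup>2 / 2 * exp ?y)"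
      using \<tau> by (simp add: power_mult_distrib power_divide)
    moreover have "?y\<^sup>2 / 2 * exp ?y \<le> exp ?y * exp ?y"
      using exp_lower_Taylor_quadratic[OF y] y by (intro mult_right_mono) auto
    moreover have "exp ?y * exp ?y = exp (\<tau> * \<bar>x\<bar>)"
      by (simp flip: exp_add)
    ultimately show ?thesis
      using mult_left_mono[of "?y\<^sup>2 / 2 * exp ?y" "exp (\<tau> * \<bar>x\<bar>)" "4 * l\<^sup>2 / \<tau>\<^sup>2"] by simp
  qed
  have "(\<integral>\<^sup>+x. ennreal (exp (l * X x)) \<partial>M)
      \<le> (\<integral>\<^sup>+x. ennreal (1 + l * X x + 4 * l\<^sup>2 / \<tau>\<^sup>2 * ?G x) \<partial>M)"
    using pt by (intro nn_integral_mono ennreal_leI)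
  also have "\<dots> = ennreal (expectation (\<lambda>x. 1 + l * X x + 4 * l\<^sup>2 / \<tau>\<^sup>2 * ?G x))"
  proof (intro nn_integral_eq_integral AE_I2)
    show "integrable M (\<lambda>x. 1 + l * X x + 4 * l\<^sup>2 / \<tau>\<^sup>2 * ?G x)"
      using X G by (intro Bochner_Integration.integrable_add integrable_mult_right) auto
    show "0 \<le> 1 + l * X x + 4 * l\<^sup>2 / \<tau>\<^sup>2 * ?G x" for x
      using order_trans[OF exp_ge_zero pt] .
  qed
  also have "\<dots> = ennreal (1 + 4 * l\<^sup>2 / \<tau>\<^sup>2 * expectation ?G)"
    using X G mean by (simp add: prob_space)
  also have "\<dots> \<le> ennreal (1 + 4 * l\<^sup>2 / \<tau>\<^sup>2 * K)"
    using GK by (intro ennreal_leI add_left_mono mult_left_mono) auto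
  also have "\<dots> \<le> ennreal (exp (4 * l\<^sup>2 * K / \<tau>\<^sup>2))"
    using exp_ge_add_one_self[of "4 * l\<^sup>2 * K / \<tau>\<^sup>2"] by (intro ennreal_leI) simp
  finally show ?thesis .
qed

text \<open>
  Chernoff's exponent per summand: \<open>l * \<epsilon> - 4 * l\<^sup>2 * K / \<tau>\<^sup>2\<close> is at least this
  for \<open>l = min (\<tau> / 2) (\<epsilon> * \<tau>\<^sup>2 / (8 * K))\<close>.
\<close>

definition tail_rate :: "real \<Rightarrow> real \<Rightarrow> real \<Rightarrow> real" where
  "tail_rate \<tau> K \<epsilon> = min (\<tau> / 2) (\<epsilon> * \<tau>\<^sup>2 / (8 * K)) * \<epsilon> / 2"

lemma tail_rate_pos: "\<tau> > 0 \<Longrightarrow> K > 0 \<Longrightarrow> \<epsilon> > 0 \<Longrightarrow> tail_rate \<tau> K \<epsilon> > 0"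
  by (simp add: tail_rate_def)

text \<open>Chernoff's method: independence factorises the exponential moment of the sum, and each
  factor costs at most half of the gain \<open>l * \<epsilon>\<close> from the threshold. The other
  half is the decay rate.\<close>

lemma (in prob_space) sum_tail_one_sided:
  fixes X :: "nat \<Rightarrow> 'a \<Rightarrow> real"
  assumes indep: "indep_vars (\<lambda>_. borel) X {..<a}"
    and mean: "\<And>k. k < a \<Longrightarrow> expectation (X k) = 0"
    and pos: "\<tau> > 0" "K > 0" "\<epsilon> > 0"
    and exp_moment: "\<And>k. k < a \<Longrightarrow> (\<integral>\<^sup>+x. ennreal (exp (\<tau> * \<bar>X k x\<bar>)) \<partial>M) \<le> ennreal K"
  shows "prob {x \<in> space M. real a * \<epsilon> \<le> (\<Sum>k<a. X k x)} \<le> exp (- tail_rate \<tau> K \<epsilon> * real a)"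
proof -
  have [measurable]: "X k \<in> borel_measurable M" if "k < a" for k
    using indep that by (auto simp: indep_vars_def)
  define l where "l = min (\<tau> / 2) (\<epsilon> * \<tau>\<^sup>2 / (8 * K))"
  have rate: "tail_rate \<tau> K \<epsilon> = l * \<epsilon> / 2" by (simp add: tail_rate_def l_def)
  have l: "l > 0" "\<bar>l\<bar> \<le> \<tau> / 2" using pos by (auto simp: l_def)
  \<comment> \<open>The second entry of the minimum is what keeps the quadratic cost below half of
    the linear gain.\<close>
  have "l \<le> \<epsilon> * \<tau>\<^sup>2 / (8 * K)" by (simp add: l_def)
  then have "l * K * 8 \<le> \<epsilon> * \<tau>\<^sup>2" using pos by (simp add: field_simps)
  then have "l * (l * K * 8) \<le> l * (\<epsilon> * \<tau>\<^sup>2)" using l by (intro mult_left_mono) auto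
  then have quad: "4 * l\<^sup>2 * K / \<tau>\<^sup>2 \<le> l * \<epsilon> / 2" using pos by (simp add: field_simps power2_eq_square)
  have S: "(\<lambda>x. (\<Sum>k<a. X k x)) \<in> borel_measurable M" by measurable
  have "(\<integral>\<^sup>+x. ennreal (exp (l * (\<Sum>k<a. X k x))) * indicator (space M) x \<partial>M)
      = (\<integral>\<^sup>+x. (\<Prod>k<a. ennreal (exp (l * X k x))) \<partial>M)"
    by (intro nn_integral_cong) (simp add: sum_distrib_left exp_sum prod_ennreal)
  also have "\<dots> = (\<Prod>k<a. \<integral>\<^sup>+x. ennreal (exp (l * X k x)) \<partial>M)"
    by (intro indep_vars_nn_integral indep_vars_compose2[OF indep]) auto
  also have "\<dots> \<le> (\<Prod>k<a. ennreal (exp (l * \<epsilon> / 2)))"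
  proof (intro prod_mono_ennreal)
    fix k assume "k \<in> {..<a}"
    then have "(\<integral>\<^sup>+x. ennreal (exp (l * X k x)) \<partial>M) \<le> ennreal (exp (4 * l\<^sup>2 * K / \<tau>\<^sup>2))"
      using l pos by (intro exp_moment_le mean exp_moment) auto
    also have "\<dots> \<le> ennreal (exp (l * \<epsilon> / 2))"
      using quad by (intro ennreal_leI) simp
    finally show "(\<integral>\<^sup>+x. ennreal (exp (l * X k x)) \<partial>M) \<le> ennreal (exp (l * \<epsilon> / 2))" .
  qed
  also have "\<dots> = ennreal (exp (real a * (l * \<epsilon> / 2)))"
    by (simp add: ennreal_power flip: exp_of_nat_mult)
  finally have moment: "(\<integral>\<^sup>+x. ennreal (exp (l * (\<Sum>k<a. X k x))) * indicator (space M) x \<partial>M)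
      \<le> ennreal (exp (real a * (l * \<epsilon> / 2)))" .
  have "emeasure M {x \<in> space M. real a * \<epsilon> \<le> (\<Sum>k<a. X k x)}
      \<le> ennreal (exp (- l * (real a * \<epsilon>)))
          * (\<integral>\<^sup>+x. ennreal (exp (l * (\<Sum>k<a. X k x))) * indicator (space M) x \<partial>M)"
    using S l by (intro Chernoff_ineq_nn_integral_ge) auto
  also have "\<dots> \<le> ennreal (exp (- l * (real a * \<epsilon>))) * ennreal (exp (real a * (l * \<epsilon> / 2)))"
    using moment by (intro mult_left_mono) auto
  also have "\<dots> = ennreal (exp (- tail_rate \<tau> K \<epsilon> * real a))"
    by (simp add: rate algebra_simps flip: ennreal_mult exp_add)
  finally show ?thesis
    by (simp add: emeasure_eq_measure)
qed

lemma (in prob_space) sum_tail: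
  fixes X :: "nat \<Rightarrow> 'a \<Rightarrow> real"
  assumes indep: "indep_vars (\<lambda>_. borel) X {..<a}"
    and mean: "\<And>k. k < a \<Longrightarrow> expectation (X k) = 0"
    and pos: "\<tau> > 0" "K > 0" "\<epsilon> > 0"
    and exp_moment: "\<And>k. k < a \<Longrightarrow> (\<integral>\<^sup>+x. ennreal (exp (\<tau> * \<bar>X k x\<bar>)) \<partial>M) \<le> ennreal K"
  shows "prob {x \<in> space M. real a * \<epsilon> \<le> \<bar>\<Sum>k<a. X k x\<bar>} \<le> 2 * exp (- tail_rate \<tau> K \<epsilon> * real a)"
proof -
  have [measurable]: "X k \<in> borel_measurable M" if "k < a" for k
    using indep that by (auto simp: indep_vars_def)
  have [measurable]: "(\<lambda>x. (\<Sum>k<a. X k x)) \<in> borel_measurable M" by measurable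
  have "{x \<in> space M. real a * \<epsilon> \<le> \<bar>\<Sum>k<a. X k x\<bar>}
      = {x \<in> space M. real a * \<epsilon> \<le> (\<Sum>k<a. X k x)} \<union> {x \<in> space M. real a * \<epsilon> \<le> (\<Sum>k<a. - X k x)}"
    by (auto simp: sum_negf)
  then have "prob {x \<in> space M. real a * \<epsilon> \<le> \<bar>\<Sum>k<a. X k x\<bar>}
      \<le> prob {x \<in> space M. real a * \<epsilon> \<le> (\<Sum>k<a. X k x)}
        + prob {x \<in> space M. real a * \<epsilon> \<le> (\<Sum>k<a. - X k x)}"
    by (simp add: sum_negf measure_Un_le)
  moreover have "prob {x \<in> space M. real a * \<epsilon> \<le> (\<Sum>k<a. X k x)} \<le> exp (- tail_rate \<tau> K \<epsilon> * real a)"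
    by (rule sum_tail_one_sided) (use assms in auto)
  moreover have "prob {x \<in> space M. real a * \<epsilon> \<le> (\<Sum>k<a. - X k x)} \<le> exp (- tail_rate \<tau> K \<epsilon> * real a)"
    by (rule sum_tail_one_sided) (use assms indep_vars_compose2[OF indep, of "\<lambda>_ x. - x"] in auto)
  ultimately show ?thesis by simp
qed

section \<open>From summable tail probabilities to almost sure convergence\<close>

lemma (in prob_space) AE_tendsto_zero_if_summable:
  fixes X :: "nat \<Rightarrow> 'a \<Rightarrow> real"
  assumes [measurable]: "\<And>n. X n \<in> borel_measurable M"
    and sum: "\<And>\<epsilon>. \<epsilon> > 0 \<Longrightarrow> summable (\<lambda>n. prob {x \<in> space M. \<epsilon> \<le> \<bar>X n x\<bar>})"
  shows "AE x in M. (\<lambda>n. X n x) \<longlonglongrightarrow> 0"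
proof -
  \<comment> \<open>Borel--Cantelli is applied at the thresholds \<open>1 / real (Suc m)\<close>
    only, so that the exceptional sets form a countable family.\<close>
  have "AE x in M. \<forall>m::nat. \<forall>\<^sub>F n in sequentially. x \<in> space M - {x \<in> space M. 1 / real (Suc m) \<le> \<bar>X n x\<bar>}"
    unfolding AE_all_countable
    by (intro allI borel_cantelli_AE1 sum) (auto simp: emeasure_eq_measure)
  then show ?thesis
  proof (eventually_elim)
    case (elim x)
    show ?case
    proof (rule tendstoI)
      fix e :: real assume "e > 0"
      then obtain m where m: "1 / real (Suc m) < e" using nat_approx_posE by blast
      show "\<forall>\<^sub>F n in sequentially. dist (X n x) 0 < e"
        using elim[rule_format, of m] by eventually_elim (use m in auto)
    qed
  qed
qed

text \<open>Exponential decay beats every power, so the terms are eventually dominated by those of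
  the given series.\<close>

lemma summable_exp_neg:
  fixes x :: "nat \<Rightarrow> real"
  assumes x: "filterlim x at_top sequentially" and c: "summable (\<lambda>n. (1 / x n) powr c)" and \<kappa>: "\<kappa> > 0"
  shows "summable (\<lambda>n. exp (- \<kappa> * x n))"
proof (rule summable_comparison_test_ev[OF _ c])
  have "((\<lambda>y. exp (- \<kappa> * y) * y powr c) \<longlongrightarrow> 0) at_top"
    using \<kappa> by real_asymp
  then have "\<forall>\<^sub>F y in at_top. exp (- \<kappa> * y) * y powr c < 1"
    by (rule order_tendstoD) simp
  then have "\<forall>\<^sub>F n in sequentially. exp (- \<kappa> * x n) * x n powr c < 1 \<and> x n > 0"
    using filterlim_iff[THEN iffD1, OF x, rule_format, of "\<lambda>y. exp (- \<kappa> * y) * y powr c < 1 \<and> y > 0"]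
    by (simp add: eventually_conj_iff eventually_gt_at_top)
  then show "\<forall>\<^sub>F n in sequentially. norm (exp (- \<kappa> * x n)) \<le> (1 / x n) powr c"
    by eventually_elim (simp add: powr_divide field_simps)
qed

section \<open>Moments of centred normal vectors\<close>

text \<open>Lebesgue measure on a Euclidean space is the image of the product of one-dimensional
  Lebesgue measures under expansion in the basis; Fubini does the rest.\<close>

lemma integral_lborel_prod:
  fixes f :: "'a::euclidean_space \<Rightarrow> real \<Rightarrow> real"
  assumes f: "\<And>b. b \<in> Basis \<Longrightarrow> integrable lborel (f b)"
  shows "(\<integral>x. (\<Prod>b\<in>Basis. f b (x \<bullet> b)) \<partial>lborel) = (\<Prod>b\<in>Basis. \<integral>x. f b x \<partial>lborel)"
proof -
  interpret product_sigma_finite "\<lambda>_::'a. lborel :: real measure" ..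
  have [measurable]: "f b \<in> borel_measurable borel" if "b \<in> Basis" for b
    using f[OF that] by auto
  have "(\<integral>x. (\<Prod>b\<in>Basis. f b (x \<bullet> b)) \<partial>lborel)
      = (\<integral>y. (\<Prod>b\<in>Basis. f b ((\<Sum>c\<in>Basis. y c *\<^sub>R c) \<bullet> b)) \<partial>(\<Pi>\<^sub>M b\<in>(Basis::'a set). lborel))"
    unfolding lborel_eq[where 'a='a] by (rule integral_distr) measurable
  also have "\<dots> = (\<integral>y. (\<Prod>b\<in>Basis. f b (y b)) \<partial>(\<Pi>\<^sub>M b\<in>(Basis::'a set). lborel))"
    by (intro Bochner_Integration.integral_cong prod.cong refl) simp
  also have "\<dots> = (\<Prod>b\<in>Basis. \<integral>x. f b x \<partial>lborel)"
    using f by (intro product_integral_prod) auto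
  finally show ?thesis .
qed

lemma prod_Basis_cart: "(\<Prod>b\<in>(Basis :: (real^'n) set). F b) = (\<Prod>i\<in>UNIV. F (axis i 1))"
proof -
  have "(Basis :: (real^'n) set) = range (\<lambda>i. axis i 1)" by (auto simp: Basis_vec_def)
  then have "(\<Prod>b\<in>(Basis :: (real^'n) set). F b) = prod F (range (\<lambda>i. axis i 1))" by simp
  also have "\<dots> = (\<Prod>i\<in>UNIV. F (axis i 1))"
    by (subst prod.reindex) (auto simp: inj_on_def axis_eq_axis)
  finally show ?thesis .
qed

text \<open>The basis vectors of \<open>real^'n\<close> are the axes; \<open>axis_index\<close>
  recovers the coordinate from the axis.\<close>

lemma integral_lborel_prod_cart:
  fixes h :: "'n::finite \<Rightarrow> real \<Rightarrow> real"
  assumes h: "\<And>i. integrable lborel (h i)"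
  shows "(\<integral>(x::real^'n). (\<Prod>i\<in>UNIV. h i (x $ i)) \<partial>lborel) = (\<Prod>i\<in>UNIV. \<integral>x. h i x \<partial>lborel)"
  using integral_lborel_prod[of "\<lambda>b :: real^'n. h (axis_index b)"] h
  by (simp add: prod_Basis_cart inner_axis axis_index_axis)

lemma nn_integral_lborel_prod_cart:
  fixes h :: "'n::finite \<Rightarrow> real \<Rightarrow> ennreal"
  assumes h: "\<And>i. h i \<in> borel_measurable borel"
  shows "(\<integral>\<^sup>+(x::real^'n). (\<Prod>i\<in>UNIV. h i (x $ i)) \<partial>lborel) = (\<Prod>i\<in>UNIV. \<integral>\<^sup>+x. h i x \<partial>lborel)"
  using nn_integral_lborel_prod[of "\<lambda>b :: real^'n. h (axis_index b)"] h
  by (simp add: prod_Basis_cart inner_axis axis_index_axis)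

text \<open>The density that occurs in \<open>standard_brownian_motion\<close>;
  \<open>\<sigma>\<close> is the standard deviation of each coordinate, not the variance.\<close>

definition centred_normal_density :: "real \<Rightarrow> real^'n \<Rightarrow> real" where
  "centred_normal_density \<sigma> x = (\<Prod>i\<in>UNIV. normal_density 0 \<sigma> (x $ i))"

lemma borel_measurable_vec_nth [measurable (raw)]:
  fixes f :: "'a \<Rightarrow> real^'n"
  assumes "f \<in> borel_measurable M" shows "(\<lambda>x. f x $ i) \<in> borel_measurable M"
  using measurable_compose[OF assms borel_measurable_nth] .

text \<open>The density is a product over coordinates, and every coordinate other than
  \<open>i\<close> integrates to \<open>1\<close>.\<close>

lemma nn_integral_normal_component:
  fixes X :: "'a \<Rightarrow> real^'n"
  assumes X: "distributed M lborel X (\<lambda>x. ennreal (centred_normal_density \<sigma> x))"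
    and \<sigma>: "\<sigma> > 0" and [measurable]: "g \<in> borel_measurable borel"
  shows "(\<integral>\<^sup>+\<omega>. g (X \<omega> $ i) \<partial>M) = (\<integral>\<^sup>+x. ennreal (normal_density 0 \<sigma> x) * g x \<partial>lborel)"
proof -
  let ?h = "\<lambda>j x. ennreal (normal_density 0 \<sigma> x) * (if j = i then g x else 1)"
  have "(\<integral>\<^sup>+\<omega>. g (X \<omega> $ i) \<partial>M) = (\<integral>\<^sup>+x. ennreal (centred_normal_density \<sigma> x) * g (x $ i) \<partial>lborel)"
    by (subst distributed_nn_integral[OF X]) auto
  also have "\<dots> = (\<integral>\<^sup>+(x::real^'n). (\<Prod>j\<in>UNIV. ?h j (x $ j)) \<partial>lborel)"
    by (intro nn_integral_cong)
       (simp add: centred_normal_density_def prod.distrib flip: prod_ennreal)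
  also have "\<dots> = (\<Prod>j\<in>UNIV. \<integral>\<^sup>+x. ?h j x \<partial>lborel)"
    by (rule nn_integral_lborel_prod_cart) measurable
  also have "\<dots> = (\<Prod>j\<in>UNIV. if j = i then \<integral>\<^sup>+x. ennreal (normal_density 0 \<sigma> x) * g x \<partial>lborel else 1)"
    using \<sigma> by (intro prod.cong) (auto simp: nn_integral_eq_integral)
  finally show ?thesis by simp
qed

text \<open>The exponent \<open>1 / (4 * \<sigma>\<^sup>2)\<close> is half of the critical one:
  tilting by it doubles the variance and leaves \<open>sqrt 2\<close> times another normal
  density.\<close>

lemma exp_moment_normal_component:
  fixes X :: "'a \<Rightarrow> real^'n"
  assumes X: "distributed M lborel X (\<lambda>x. ennreal (centred_normal_density \<sigma> x))" and \<sigma>: "\<sigma> > 0"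
  shows "(\<integral>\<^sup>+\<omega>. ennreal (exp ((X \<omega> $ i)\<^sup>2 / (4 * \<sigma>\<^sup>2))) \<partial>M) = ennreal (sqrt 2)"
proof -
  have "normal_density 0 \<sigma> x * exp (x\<^sup>2 / (4 * \<sigma>\<^sup>2)) = sqrt 2 * normal_density 0 (sqrt 2 * \<sigma>) x" for x
  proof -
    have "exp (- (x\<^sup>2) / (2 * \<sigma>\<^sup>2)) * exp (x\<^sup>2 / (4 * \<sigma>\<^sup>2)) = exp (- (x\<^sup>2) / (2 * (sqrt 2 * \<sigma>)\<^sup>2))"
      using \<sigma> by (simp add: power_mult_distrib field_simps flip: exp_add)
    moreover have "sqrt (2 * pi * (sqrt 2 * \<sigma>)\<^sup>2) = sqrt 2 * sqrt (2 * pi * \<sigma>\<^sup>2)"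
      by (simp add: power_mult_distrib flip: real_sqrt_mult)
    ultimately show ?thesis
      by (simp add: normal_density_def)
  qed
  then have "(\<integral>\<^sup>+x. ennreal (normal_density 0 \<sigma> x) * ennreal (exp (x\<^sup>2 / (4 * \<sigma>\<^sup>2))) \<partial>lborel)
      = (\<integral>\<^sup>+x. ennreal (sqrt 2 * normal_density 0 (sqrt 2 * \<sigma>) x) \<partial>lborel)"
    by (simp flip: ennreal_mult)
  also have "\<dots> = ennreal (sqrt 2)"
    using \<sigma> by (subst nn_integral_eq_integral) auto
  finally show ?thesis
    using nn_integral_normal_component[OF X \<sigma>, of "\<lambda>x. ennreal (exp (x\<^sup>2 / (4 * \<sigma>\<^sup>2)))" i] by simp
qed

lemma covariance_normal_component:
  fixes X :: "'a \<Rightarrow> real^'n"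
  assumes X: "distributed M lborel X (\<lambda>x. ennreal (centred_normal_density \<sigma> x))" and \<sigma>: "\<sigma> > 0"
  shows "(\<integral>\<omega>. X \<omega> $ i * X \<omega> $ j \<partial>M) = (if i = j then \<sigma>\<^sup>2 else 0)"
proof -
  \<comment> \<open>Writing the product of two coordinates as a monomial treats both cases at once:
    the exponent is \<open>2\<close> at \<open>i\<close> if \<open>i = j\<close>, otherwise
    \<open>1\<close> at each of \<open>i\<close> and \<open>j\<close>. The integral becomes a
    product of one-dimensional moments, and a first moment is zero.\<close>
  let ?e = "\<lambda>k. (if k = i then 1 else 0) + (if k = j then 1 else 0 :: nat)"
  let ?h = "\<lambda>k x. normal_density 0 \<sigma> x * x ^ ?e k"
  have int: "integrable lborel (?h k)" for k
    using integrable_normal_moment[OF \<sigma>, of 0 "?e k"] by simp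
  have "(\<Prod>k\<in>UNIV. (x::real^'n) $ k ^ ?e k) = x $ i * x $ j" for x
    by (simp add: power_add prod.distrib if_distrib[of "\<lambda>e. _ ^ e"] cong: if_cong)
  then have "(\<integral>\<omega>. X \<omega> $ i * X \<omega> $ j \<partial>M) = (\<integral>(x::real^'n). (\<Prod>k\<in>UNIV. ?h k (x $ k)) \<partial>lborel)"
    by (subst distributed_integral[OF X, symmetric])
       (auto simp: centred_normal_density_def prod.distrib prod_nonneg)
  also have "\<dots> = (\<Prod>k\<in>UNIV. \<integral>x. ?h k x \<partial>lborel)"
    by (rule integral_lborel_prod_cart) (rule int)
  also have "\<dots> = (if i = j then \<sigma>\<^sup>2 else 0)"
  proof (cases "i = j")
    case True
    have "(\<integral>x. ?h k x \<partial>lborel) = (if k = i then \<sigma>\<^sup>2 else 1)" for k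
      using True integral_normal_moment_even[OF \<sigma>, of 0 1] \<sigma> by (simp add: numeral_2_eq_2)
    then show ?thesis using True by simp
  next
    case False
    have "(\<integral>x. ?h i x \<partial>lborel) = 0"
      using False integral_normal_moment_odd[OF \<sigma>, of 0 0] by simp
    then show ?thesis using False by (subst prod_zero) auto
  qed
  finally show ?thesis .
qed

section \<open>Brownian increments over batches\<close>

text \<open>Batches are counted from \<open>0\<close>, and the increment is not normalised: for a
  standard Brownian motion each coordinate has variance \<open>m\<close>.\<close>

definition increment :: "(real \<Rightarrow> 'b \<Rightarrow> real^'p) \<Rightarrow> nat \<Rightarrow> nat \<Rightarrow> 'b \<Rightarrow> real^'p" where
  "increment B m k \<omega> = B (real (Suc k * m)) \<omega> - B (real (k * m)) \<omega>"

lemma brownian_distributed: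
  assumes "standard_brownian_motion N B" "0 \<le> s" "s < t"
  shows "distributed N lborel (\<lambda>\<omega>. B t \<omega> - B s \<omega>) (\<lambda>x. ennreal (centred_normal_density (sqrt (t - s)) x))"
  using assms unfolding standard_brownian_motion_def centred_normal_density_def by blast

lemma increment_distributed:
  assumes "standard_brownian_motion N B" "m > 0"
  shows "distributed N lborel (increment B m k) (\<lambda>x. ennreal (centred_normal_density (sqrt (real m)) x))"
  using brownian_distributed[OF assms(1), of "real (k * m)" "real (Suc k * m)"] assms(2)
  by (simp add: increment_def[abs_def] algebra_simps)

lemma borel_measurable_increment:
  assumes "standard_brownian_motion N B"
  shows "increment B m k \<in> borel_measurable N"
  using assms unfolding increment_def[abs_def] standard_brownian_motion_def
  by (intro borel_measurable_diff) auto

lemma increments_indep: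
  assumes bm: "standard_brownian_motion N B" and m: "m > 0"
  shows "prob_space.indep_vars N (\<lambda>_. borel) (increment B m) {..<a}"
proof -
  have "\<forall>k (t :: nat \<Rightarrow> real). 0 \<le> t 0 \<and> (\<forall>i<k. t i < t (Suc i)) \<longrightarrow>
      prob_space.indep_vars N (\<lambda>_. borel) (\<lambda>i \<omega>. B (t (Suc i)) \<omega> - B (t i) \<omega>) {..<k}"
    using bm unfolding standard_brownian_motion_def by (elim conjE)
  from this[rule_format, of "\<lambda>i. real (i * m)" a] m show ?thesis
    by (simp add: increment_def[abs_def])
qed

definition centred_product :: "(real \<Rightarrow> 'b \<Rightarrow> real^'p) \<Rightarrow> nat \<Rightarrow> 'p \<Rightarrow> 'p \<Rightarrow> nat \<Rightarrow> 'b \<Rightarrow> real" where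
  "centred_product B m i j k \<omega> =
     increment B m k \<omega> $ i * increment B m k \<omega> $ j / real m - (if i = j then 1 else 0)"

text \<open>The inequality between arithmetic and geometric means is used twice, first to pass from
  the product to squares of single coordinates, then to separate the two exponentials. The weight
  \<open>1/4\<close> matches the exponent at which a squared coordinate has exponential moment
  \<open>sqrt 2\<close>; the factor \<open>exp (1/4)\<close> pays for the centring.\<close>

lemma exp_moment_centred_product:
  assumes bm: "standard_brownian_motion N B" and m: "m > 0"
  shows "(\<integral>\<^sup>+\<omega>. ennreal (exp (1/4 * \<bar>centred_product B m i j k \<omega>\<bar>)) \<partial>N) \<le> ennreal (exp (1/4) * sqrt 2)"
proof -
  note [measurable] = borel_measurable_increment[OF bm]
  let ?W = "increment B m k"
  define P where "P l \<omega> = (?W \<omega> $ l)\<^sup>2 / (4 * real m)" for l \<omega>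
  have [measurable]: "P l \<in> borel_measurable N" for l
    unfolding P_def[abs_def] by measurable
  have P: "(\<integral>\<^sup>+\<omega>. ennreal (exp (P l \<omega>)) \<partial>N) = ennreal (sqrt 2)" for l
    using exp_moment_normal_component[OF increment_distributed[OF bm m]] m by (simp add: P_def)
  have "exp (1/4 * \<bar>centred_product B m i j k \<omega>\<bar>) \<le> exp (1/4) / 2 * (exp (P i \<omega>) + exp (P j \<omega>))" for \<omega>
  proof -
    have "2 * \<bar>?W \<omega> $ i * ?W \<omega> $ j\<bar> \<le> (?W \<omega> $ i)\<^sup>2 + (?W \<omega> $ j)\<^sup>2"
      using sum_squares_bound[of "\<bar>?W \<omega> $ i\<bar>" "\<bar>?W \<omega> $ j\<bar>"] by (simp add: abs_mult)
    then have "\<bar>?W \<omega> $ i * ?W \<omega> $ j / real m\<bar> / 4 \<le> (P i \<omega> + P j \<omega>) / 2"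
      using m by (simp add: P_def field_simps)
    moreover have "\<bar>centred_product B m i j k \<omega>\<bar> \<le> \<bar>?W \<omega> $ i * ?W \<omega> $ j / real m\<bar> + 1"
      unfolding centred_product_def by (rule order_trans[OF abs_triangle_ineq4]) auto
    moreover have "1/4 * c \<le> 1/4 + q" if "w / 4 \<le> q" "c \<le> w + 1" for c w q :: real
      using that by simp
    ultimately have "1/4 * \<bar>centred_product B m i j k \<omega>\<bar> \<le> 1/4 + (P i \<omega> + P j \<omega>) / 2"
      by blast
    then have "exp (1/4 * \<bar>centred_product B m i j k \<omega>\<bar>) \<le> exp (1/4 + (P i \<omega> + P j \<omega>) / 2)"
      unfolding exp_le_cancel_iff .
    also have "\<dots> = exp (1/4) * (exp (P i \<omega> / 2) * exp (P j \<omega> / 2))"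
      by (simp add: exp_add add_divide_distrib)
    also have "\<dots> \<le> exp (1/4) * ((exp (P i \<omega>) + exp (P j \<omega>)) / 2)"
    proof (rule mult_left_mono)
      have "(exp (P l \<omega> / 2))\<^sup>2 = exp (P l \<omega>)" for l
        by (simp add: power2_eq_square flip: exp_add)
      then show "exp (P i \<omega> / 2) * exp (P j \<omega> / 2) \<le> (exp (P i \<omega>) + exp (P j \<omega>)) / 2"
        using sum_squares_bound[of "exp (P i \<omega> / 2)" "exp (P j \<omega> / 2)"] by simp
    qed simp
    finally show ?thesis by simp
  qed
  then have "(\<integral>\<^sup>+\<omega>. ennreal (exp (1/4 * \<bar>centred_product B m i j k \<omega>\<bar>)) \<partial>N)
      \<le> (\<integral>\<^sup>+\<omega>. ennreal (exp (1/4) / 2) * (ennreal (exp (P i \<omega>)) + ennreal (exp (P j \<omega>))) \<partial>N)"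
    by (intro nn_integral_mono) (simp add: ennreal_leI flip: ennreal_mult ennreal_plus)
  also have "\<dots> = ennreal (exp (1/4) / 2) * (ennreal (sqrt 2) + ennreal (sqrt 2))"
    by (simp add: nn_integral_cmult nn_integral_add P)
  also have "\<dots> = ennreal (exp (1/4) * sqrt 2)"
    by (simp flip: ennreal_mult ennreal_plus)
  finally show ?thesis .
qed

lemma mean_centred_product:
  assumes bm: "standard_brownian_motion N B" and m: "m > 0"
  shows "(\<integral>\<omega>. centred_product B m i j k \<omega> \<partial>N) = 0"
proof -
  interpret prob_space N using bm by (simp add: standard_brownian_motion_def)
  note [measurable] = borel_measurable_increment[OF bm]
  let ?W = "increment B m k"
  have "integrable N (\<lambda>\<omega>. exp (1/4 * \<bar>centred_product B m i j k \<omega>\<bar>))"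
  proof (rule integrableI_nonneg)
    show "(\<integral>\<^sup>+\<omega>. ennreal (exp (1/4 * \<bar>centred_product B m i j k \<omega>\<bar>)) \<partial>N) < \<infinity>"
      using exp_moment_centred_product[OF bm m] by (rule order.strict_trans1) simp
  qed (auto simp: centred_product_def)
  then have "integrable N (\<lambda>\<omega>. 4 * exp (1/4 * \<bar>centred_product B m i j k \<omega>\<bar>))" by simp
  then have "integrable N (centred_product B m i j k)"
  proof (rule Bochner_Integration.integrable_bound)
    have "\<bar>x\<bar> \<le> 4 * exp (1/4 * \<bar>x\<bar>)" for x :: real
      using exp_ge_add_one_self[of "1/4 * \<bar>x\<bar>"] by linarith
    then show "AE \<omega> in N. norm (centred_product B m i j k \<omega>)
        \<le> norm (4 * exp (1/4 * \<bar>centred_product B m i j k \<omega>\<bar>))" by simp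
  qed (simp add: centred_product_def[abs_def])
  \<comment> \<open>Integrability of the uncentred product lets the expectation be split into the
    covariance and the centring constant.\<close>
  then have "integrable N (\<lambda>\<omega>. centred_product B m i j k \<omega> + (if i = j then 1 else 0))"
    by (intro Bochner_Integration.integrable_add) auto
  then have "integrable N (\<lambda>\<omega>. ?W \<omega> $ i * ?W \<omega> $ j / real m)"
    by (simp add: centred_product_def)
  then show ?thesis
    using covariance_normal_component[OF increment_distributed[OF bm m], of k i j] m
    by (simp add: centred_product_def prob_space)
qed

section \<open>Rates from the batch size condition and almost sure limits\<close>

text \<open>
  All exponential tail bounds are summable, since \<open>exp (- \<kappa> * (n / b n))\<close> is eventually
  below \<open>(b n / n) powr c\<close>.
\<close>

lemma batch_size_exp_summable:
  assumes "batch_size_condition b" "\<kappa> > 0"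
  shows "summable (\<lambda>n. exp (- \<kappa> * (real n / real (b n))))"
proof -
  obtain c where "summable (\<lambda>n. (real (b n) / real n) powr c)"
    using assms(1) by (auto simp: batch_size_condition_def)
  then show ?thesis
    using assms by (intro summable_exp_neg[where c = c]) (auto simp: batch_size_condition_def)
qed

lemma batch_size_eventually_pos:
  assumes "batch_size_condition b"
  shows "\<forall>\<^sub>F n in sequentially. b n > 0"
  using assms eventually_compose_filterlim[OF eventually_gt_at_top[of 0]]
  by (auto simp: batch_size_condition_def)

lemma batch_count_ge:
  fixes n m :: nat
  shows "real n / real m - 1 \<le> real (n div m)"
  using floor_divide_of_nat_eq[of n m, where 'a = real] by linarith

lemma filterlim_batch_count:
  assumes "batch_size_condition b"
  shows "filterlim (\<lambda>n. n div b n) at_top sequentially"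
proof -
  have "filterlim (\<lambda>n. - 1 + real n / real (b n)) at_top sequentially"
    using assms by (intro filterlim_tendsto_add_at_top[OF tendsto_const]) (auto simp: batch_size_condition_def)
  then have "filterlim (\<lambda>n. real (n div b n)) at_top sequentially"
    by (rule filterlim_at_top_mono) (use batch_count_ge in \<open>auto simp: algebra_simps\<close>)
  then show ?thesis by (simp add: filterlim_sequentially_iff_filterlim_real)
qed

text \<open>The blocks change with \<open>n\<close>, so the summands form a triangular array.
  Independence within a row gives an exponential tail bound, and Borel--Cantelli across the rows
  gives convergence.\<close>

lemma AE_batch_covariance:
  assumes bm: "standard_brownian_motion N B" and b: "batch_size_condition b"
  shows "AE \<omega> in N. (\<lambda>n. (\<Sum>k<n div b n. increment B (b n) k \<omega> $ i * increment B (b n) k \<omega> $ j / real (b n))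
            / real (n div b n)) \<longlonglongrightarrow> (if i = j then 1 else 0)"
proof -
  interpret prob_space N using bm by (simp add: standard_brownian_motion_def)
  note [measurable] = borel_measurable_increment[OF bm]
  let ?a = "\<lambda>n. n div b n"
  let ?X = "\<lambda>n \<omega>. (\<Sum>k<?a n. centred_product B (b n) i j k \<omega>) / real (?a n)"
  have ev: "\<forall>\<^sub>F n in sequentially. b n > 0 \<and> ?a n > 0"
    using batch_size_eventually_pos[OF b]
      eventually_compose_filterlim[OF eventually_gt_at_top[of 0] filterlim_batch_count[OF b]]
    by (rule eventually_conj)
  have "AE \<omega> in N. (\<lambda>n. ?X n \<omega>) \<longlonglongrightarrow> 0"
  proof (rule AE_tendsto_zero_if_summable)
    show "?X n \<in> borel_measurable N" for n
      unfolding centred_product_def by measurable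
    fix \<epsilon> :: real assume \<epsilon>: "\<epsilon> > 0"
    define \<kappa> where "\<kappa> = tail_rate (1/4) (exp (1/4) * sqrt 2) \<epsilon>"
    have \<kappa>: "\<kappa> > 0" unfolding \<kappa>_def using \<epsilon> by (intro tail_rate_pos) auto
    show "summable (\<lambda>n. prob {\<omega> \<in> space N. \<epsilon> \<le> \<bar>?X n \<omega>\<bar>})"
    proof (rule summable_comparison_test_ev)
      \<comment> \<open>The factor \<open>exp \<kappa>\<close> compensates for rounding down:
        \<open>n div b n\<close> exceeds \<open>n / b n - 1\<close>, which loses at most one unit in
        the exponent before scaling by \<open>\<kappa>\<close>.\<close>
      show "summable (\<lambda>n. 2 * exp \<kappa> * exp (- \<kappa> * (real n / real (b n))))"
        using batch_size_exp_summable[OF b \<kappa>] by (rule summable_mult)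
      show "\<forall>\<^sub>F n in sequentially. norm (prob {\<omega> \<in> space N. \<epsilon> \<le> \<bar>?X n \<omega>\<bar>})
          \<le> 2 * exp \<kappa> * exp (- \<kappa> * (real n / real (b n)))"
        using ev
      proof eventually_elim
        case (elim n)
        have "indep_vars (\<lambda>_. borel) (centred_product B (b n) i j) {..<?a n}"
          unfolding centred_product_def
          using elim by (intro indep_vars_compose2[OF increments_indep[OF bm]]) auto
        then have "prob {\<omega> \<in> space N. real (?a n) * \<epsilon> \<le> \<bar>\<Sum>k<?a n. centred_product B (b n) i j k \<omega>\<bar>}
            \<le> 2 * exp (- \<kappa> * real (?a n))"
          unfolding \<kappa>_def using elim \<epsilon>
          by (intro sum_tail mean_centred_product[OF bm] exp_moment_centred_product[OF bm]) auto
        moreover have "{\<omega> \<in> space N. real (?a n) * \<epsilon> \<le> \<bar>\<Sum>k<?a n. centred_product B (b n) i j k \<omega>\<bar>}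
            = {\<omega> \<in> space N. \<epsilon> \<le> \<bar>?X n \<omega>\<bar>}"
          using elim by (intro Collect_cong) (auto simp: abs_divide pos_le_divide_eq mult.commute)
        moreover have "exp (- \<kappa> * real (?a n)) \<le> exp (\<kappa> + - \<kappa> * (real n / real (b n)))"
          using mult_left_mono[OF batch_count_ge[of n "b n"], of \<kappa>] \<kappa> by (simp add: algebra_simps)
        ultimately show ?case
          unfolding exp_add by (simp only: real_norm_def abs_of_nonneg[OF measure_nonneg])
      qed
    qed
  qed
  then show ?thesis
  proof eventually_elim
    case (elim \<omega>)
    from tendsto_add[OF elim tendsto_const]
    have "(\<lambda>n. ?X n \<omega> + (if i = j then 1 else 0)) \<longlonglongrightarrow> (if i = j then 1 else 0)" by simp
    then show ?case
    proof (rule Lim_transform_eventually)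
      show "\<forall>\<^sub>F n in sequentially. ?X n \<omega> + (if i = j then 1 else 0) =
          (\<Sum>k<?a n. increment B (b n) k \<omega> $ i * increment B (b n) k \<omega> $ j / real (b n)) / real (?a n)"
        using ev by eventually_elim (simp add: centred_product_def sum_subtractf diff_divide_distrib)
    qed
  qed
qed

text \<open>
  A Gaussian tail bound and Borel--Cantelli along the integers replace the law of the iterated
  logarithm.
\<close>

lemma AE_brownian_negligible:
  assumes bm: "standard_brownian_motion N B" and b: "batch_size_condition b"
  shows "AE \<omega> in N. (\<lambda>n. sqrt (real (b n)) / real n * B (real n) \<omega> $ i) \<longlonglongrightarrow> 0"
proof -
  interpret prob_space N using bm by (simp add: standard_brownian_motion_def)
  have [measurable]: "B t \<in> borel_measurable N" if "t \<ge> 0" for t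
    using bm that by (simp add: standard_brownian_motion_def)
  \<comment> \<open>The prescribed law is that of increments, and \<open>B 0\<close> vanishes only
    almost surely, so it is subtracted here and removed at the end.\<close>
  let ?W = "\<lambda>n \<omega>. B (real n) \<omega> - B 0 \<omega>"
  let ?X = "\<lambda>n \<omega>. sqrt (real (b n)) / real n * (?W n \<omega> $ i)"
  have "AE \<omega> in N. (\<lambda>n. ?X n \<omega>) \<longlonglongrightarrow> 0"
  proof (rule AE_tendsto_zero_if_summable)
    show "?X n \<in> borel_measurable N" for n by measurable
    fix \<epsilon> :: real assume \<epsilon>: "\<epsilon> > 0"
    show "summable (\<lambda>n. prob {\<omega> \<in> space N. \<epsilon> \<le> \<bar>?X n \<omega>\<bar>})"
    proof (rule summable_comparison_test_ev)
      show "summable (\<lambda>n. exp (- (\<epsilon>\<^sup>2 / 4) * (real n / real (b n))) * sqrt 2)"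
        using \<epsilon> by (intro summable_mult2 batch_size_exp_summable[OF b]) auto
      show "\<forall>\<^sub>F n in sequentially. norm (prob {\<omega> \<in> space N. \<epsilon> \<le> \<bar>?X n \<omega>\<bar>})
          \<le> exp (- (\<epsilon>\<^sup>2 / 4) * (real n / real (b n))) * sqrt 2"
        using batch_size_eventually_pos[OF b] eventually_gt_at_top[of 0]
      proof eventually_elim
        case (elim n)
        have dist: "distributed N lborel (?W n) (\<lambda>x. ennreal (centred_normal_density (sqrt (real n)) x))"
          using brownian_distributed[OF bm, of 0 "real n"] elim by simp
        have "{\<omega> \<in> space N. \<epsilon> \<le> \<bar>?X n \<omega>\<bar>}
            = {\<omega> \<in> space N. \<epsilon>\<^sup>2 * (real n)\<^sup>2 / real (b n) \<le> (?W n \<omega> $ i)\<^sup>2}"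
        proof (intro Collect_cong conj_cong refl)
          fix \<omega>
          have "\<epsilon> \<le> \<bar>?X n \<omega>\<bar> \<longleftrightarrow> \<epsilon>\<^sup>2 \<le> (?X n \<omega>)\<^sup>2"
            using \<epsilon> abs_le_square_iff[of \<epsilon> "?X n \<omega>"] by simp
          also have "(?X n \<omega>)\<^sup>2 = real (b n) / (real n)\<^sup>2 * (?W n \<omega> $ i)\<^sup>2"
            by (simp only: power_mult_distrib power_divide real_sqrt_pow2 of_nat_0_le_iff)
          also have "\<epsilon>\<^sup>2 \<le> \<dots> \<longleftrightarrow> \<epsilon>\<^sup>2 * (real n)\<^sup>2 / real (b n) \<le> (?W n \<omega> $ i)\<^sup>2"
            using elim by (simp add: divide_simps mult.commute)
          finally show "\<epsilon> \<le> \<bar>?X n \<omega>\<bar> \<longleftrightarrow> \<epsilon>\<^sup>2 * (real n)\<^sup>2 / real (b n) \<le> (?W n \<omega> $ i)\<^sup>2" .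
        qed
        then have "emeasure N {\<omega> \<in> space N. \<epsilon> \<le> \<bar>?X n \<omega>\<bar>}
            = emeasure N {\<omega> \<in> space N. \<epsilon>\<^sup>2 * (real n)\<^sup>2 / real (b n) \<le> (?W n \<omega> $ i)\<^sup>2}" by simp
        \<comment> \<open>Chernoff's bound is applied to the squared coordinate, whose exponential
          moment at \<open>1 / (4 * real n)\<close> is \<open>sqrt 2\<close>; times the threshold
          this gives the exponent \<open>\<epsilon>\<^sup>2 / 4 * (n / b n)\<close>.\<close>
        also have "\<dots> \<le> ennreal (exp (- (1 / (4 * real n)) * (\<epsilon>\<^sup>2 * (real n)\<^sup>2 / real (b n))))
            * (\<integral>\<^sup>+\<omega>. ennreal (exp (1 / (4 * real n) * (?W n \<omega> $ i)\<^sup>2)) * indicator (space N) \<omega> \<partial>N)"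
          using elim by (intro Chernoff_ineq_nn_integral_ge) auto
        also have "(\<integral>\<^sup>+\<omega>. ennreal (exp (1 / (4 * real n) * (?W n \<omega> $ i)\<^sup>2)) * indicator (space N) \<omega> \<partial>N)
            = (\<integral>\<^sup>+\<omega>. ennreal (exp ((?W n \<omega> $ i)\<^sup>2 / (4 * (sqrt (real n))\<^sup>2))) \<partial>N)"
          by (intro nn_integral_cong) simp
        also have "\<dots> = ennreal (sqrt 2)"
          using elim by (intro exp_moment_normal_component[OF dist]) simp
        finally have "prob {\<omega> \<in> space N. \<epsilon> \<le> \<bar>?X n \<omega>\<bar>}
            \<le> exp (- (1 / (4 * real n)) * (\<epsilon>\<^sup>2 * (real n)\<^sup>2 / real (b n))) * sqrt 2"
          by (simp add: emeasure_eq_measure flip: ennreal_mult)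
        also have "- (1 / (4 * real n)) * (\<epsilon>\<^sup>2 * (real n)\<^sup>2 / real (b n)) = - (\<epsilon>\<^sup>2 / 4) * (real n / real (b n))"
          using elim by (simp add: power2_eq_square)
        finally show ?case by simp
      qed
    qed
  qed
  moreover have "AE \<omega> in N. B 0 \<omega> = 0"
    using bm by (simp add: standard_brownian_motion_def)
  ultimately show ?thesis by eventually_elim simp
qed

section \<open>Consistency along a trajectory\<close>

text \<open>The difference of the products consists of one term quadratic in the errors and two
  mixed terms. Since \<open>\<bar>u\<bar> \<le> 1 + u * u\<close>, the mixed terms are controlled by
  \<open>\<rho>\<close> and the averaged squares, which converge and hence stay bounded.\<close>

lemma perturbed_products_tendsto:
  fixes x x' p p' :: "nat \<Rightarrow> nat \<Rightarrow> real" and a :: "nat \<Rightarrow> nat"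
  assumes a: "filterlim a at_top sequentially"
    and s: "(\<lambda>n. (\<Sum>k<a n. x n k * x' n k) / real (a n)) \<longlonglongrightarrow> s"
    and s1: "(\<lambda>n. (\<Sum>k<a n. x n k * x n k) / real (a n)) \<longlonglongrightarrow> s1"
    and s2: "(\<lambda>n. (\<Sum>k<a n. x' n k * x' n k) / real (a n)) \<longlonglongrightarrow> s2"
    and p: "\<forall>\<^sub>F n in sequentially. \<forall>k<a n. \<bar>p n k - x n k\<bar> \<le> \<rho> n"
    and p': "\<forall>\<^sub>F n in sequentially. \<forall>k<a n. \<bar>p' n k - x' n k\<bar> \<le> \<rho> n"
    and \<rho>: "\<rho> \<longlonglongrightarrow> 0"
  shows "(\<lambda>n. (\<Sum>k<a n. p n k * p' n k) / (real (a n) - 1)) \<longlonglongrightarrow> s"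
proof -
  let ?avg = "\<lambda>f n. (\<Sum>k<a n. f n k) / real (a n)"
  define err where "err n = (\<rho> n)\<^sup>2 + 2 * \<rho> n + \<rho> n * ?avg (\<lambda>n k. x n k * x n k) n
    + \<rho> n * ?avg (\<lambda>n k. x' n k * x' n k) n" for n
  have a_pos: "\<forall>\<^sub>F n in sequentially. a n > 0"
    using eventually_compose_filterlim[OF eventually_gt_at_top[of 0] a] .
  have "err \<longlonglongrightarrow> 0\<^sup>2 + 2 * 0 + 0 * s1 + 0 * s2"
    unfolding err_def by (intro tendsto_intros \<rho> s1 s2)
  then have err: "err \<longlonglongrightarrow> 0" by simp
  have "\<forall>\<^sub>F n in sequentially.
      norm (?avg (\<lambda>n k. p n k * p' n k) n - ?avg (\<lambda>n k. x n k * x' n k) n) \<le> err n"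
    using p p' a_pos
  proof eventually_elim
    case (elim n)
    have "\<bar>p n k * p' n k - x n k * x' n k\<bar>
        \<le> (\<rho> n)\<^sup>2 + 2 * \<rho> n + \<rho> n * (x n k * x n k) + \<rho> n * (x' n k * x' n k)" if k: "k < a n" for k
    proof -
      let ?d = "p n k - x n k" and ?d' = "p' n k - x' n k"
      have d: "\<bar>?d\<bar> \<le> \<rho> n" "\<bar>?d'\<bar> \<le> \<rho> n" using elim k by auto
      then have \<rho>0: "\<rho> n \<ge> 0" by linarith
      have sq: "\<bar>u\<bar> \<le> 1 + u * u" for u :: real
        using sum_squares_bound[of 1 "\<bar>u\<bar>"] by (simp add: power2_eq_square)
      have "p n k * p' n k - x n k * x' n k = ?d * ?d' + ?d * x' n k + ?d' * x n k"
        by (simp add: algebra_simps)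
      also have "\<bar>\<dots>\<bar> \<le> \<bar>?d\<bar> * \<bar>?d'\<bar> + \<bar>?d\<bar> * \<bar>x' n k\<bar> + \<bar>?d'\<bar> * \<bar>x n k\<bar>"
        unfolding abs_mult[symmetric] by linarith
      also have "\<dots> \<le> \<rho> n * \<rho> n + \<rho> n * (1 + x' n k * x' n k) + \<rho> n * (1 + x n k * x n k)"
        using d \<rho>0 sq by (intro add_mono mult_mono) auto
      finally show ?thesis by (simp add: power2_eq_square algebra_simps)
    qed
    then have "(\<Sum>k<a n. \<bar>p n k * p' n k - x n k * x' n k\<bar>)
        \<le> (\<Sum>k<a n. (\<rho> n)\<^sup>2 + 2 * \<rho> n + \<rho> n * (x n k * x n k) + \<rho> n * (x' n k * x' n k))"
      by (intro sum_mono) auto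
    also have "\<dots> = real (a n) * err n"
      using elim by (simp add: err_def sum.distrib sum_distrib_left[symmetric] field_simps)
    finally have "\<bar>\<Sum>k<a n. p n k * p' n k - x n k * x' n k\<bar> \<le> real (a n) * err n"
      by (rule order_trans[OF sum_abs])
    then have "\<bar>(\<Sum>k<a n. p n k * p' n k - x n k * x' n k) / real (a n)\<bar> \<le> err n"
      using elim by (simp add: abs_divide pos_divide_le_eq mult.commute)
    then show ?case
      by (simp add: sum_subtractf diff_divide_distrib)
  qed
  then have "(\<lambda>n. ?avg (\<lambda>n k. p n k * p' n k) n - ?avg (\<lambda>n k. x n k * x' n k) n) \<longlonglongrightarrow> 0"
    using err by (rule Lim_null_comparison)
  from tendsto_add[OF this s] have avg: "?avg (\<lambda>n k. p n k * p' n k) \<longlonglongrightarrow> s" by simp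
  \<comment> \<open>Passes from the divisor \<open>a n\<close> to the divisor \<open>a n - 1\<close>
    of the estimator.\<close>
  have "((\<lambda>m. real m / (real m - 1)) \<longlongrightarrow> 1) sequentially" by real_asymp
  from filterlim_compose[OF this a] have "(\<lambda>n. real (a n) / (real (a n) - 1)) \<longlonglongrightarrow> 1" .
  from tendsto_mult[OF avg this]
  have "(\<lambda>n. ?avg (\<lambda>n k. p n k * p' n k) n * (real (a n) / (real (a n) - 1))) \<longlonglongrightarrow> s" by simp
  then show ?thesis
    by (rule Lim_transform_eventually) (use a_pos in eventually_elim, simp)
qed

section \<open>Batch means in terms of partial sums, and the deterministic limit\<close>

lemma batch_means_estimator_component:
  "batch_means_estimator b y n $ i $ j =
     real (b n) / (real (n div b n) - 1) *
       (\<Sum>k<n div b n. (batch_mean y (b n) k - sample_mean y n) $ i * (batch_mean y (b n) k - sample_mean y n) $ j)"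
  unfolding batch_means_estimator_def Let_def vector_scaleR_component sum_component real_scaleR_def
  by (simp add: matrix_matrix_mult_def columnvector_def rowvector_def)

lemma scaled_sample_mean: "real n *\<^sub>R sample_mean y n = (\<Sum>t=1..n. y t)"
  by (simp add: sample_mean_def)

text \<open>A batch sum is a difference of two partial sums, the quantities that the invariance
  principle approximates. For \<open>k = 0\<close> the subtracted term is zero because of its
  factor.\<close>

lemma scaled_batch_mean:
  fixes y :: "nat \<Rightarrow> real^'p"
  assumes "m > 0"
  shows "real m *\<^sub>R batch_mean y m k =
    real (Suc k * m) *\<^sub>R sample_mean y (Suc k * m) - real (k * m) *\<^sub>R sample_mean y (k * m)"
proof -
  have "(\<Sum>t=1..Suc k * m. y t) = (\<Sum>t=1..k * m. y t) + (\<Sum>t=k * m + 1..k * m + m. y t)"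
    using sum.ub_add_nat[of 1 "k * m" y m] by (simp add: add.commute)
  also have "(\<Sum>t=k * m + 1..k * m + m. y t) = (\<Sum>t=1..m. y (k * m + t))"
    using sum.shift_bounds_cl_nat_ivl[of y 1 "k * m" m] by (simp add: add.commute)
  finally show ?thesis
    unfolding scaled_sample_mean using assms by (simp add: batch_mean_def)
qed

text \<open>The invariance principle speaks of large times only, while early batches end at small
  ones. The finitely many early errors go into \<open>C\<close>; monotonicity of
  \<open>\<gamma>\<close> replaces \<open>\<gamma> j\<close> by \<open>\<gamma> n\<close> for the
  others.\<close>

lemma extend_eventual_bound:
  fixes E :: "nat \<Rightarrow> 'v::real_normed_vector" and \<gamma> :: "nat \<Rightarrow> real"
  assumes E: "\<forall>\<^sub>F n in sequentially. norm (E n) < D * \<gamma> n"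
    and \<gamma>: "\<And>n. n \<ge> 1 \<Longrightarrow> 0 \<le> \<gamma> n" "mono_on {1..} \<gamma>"
  obtains C where "\<And>j n. j \<le> n \<Longrightarrow> n \<ge> 1 \<Longrightarrow> norm (E j) \<le> C + \<bar>D\<bar> * \<gamma> n"
proof -
  obtain n0 where n0: "\<And>n. n \<ge> n0 \<Longrightarrow> norm (E n) < D * \<gamma> n"
    using E by (auto simp: eventually_sequentially)
  \<comment> \<open>Summing up to and including \<open>n0\<close> leaves only indices of at least
    \<open>1\<close>, where the assumptions on \<open>\<gamma>\<close> apply.\<close>
  define C where "C = (\<Sum>j<Suc n0. norm (E j))"
  have C: "C \<ge> 0" unfolding C_def by (intro sum_nonneg) auto
  have "norm (E j) \<le> C + \<bar>D\<bar> * \<gamma> n" if j: "j \<le> n" "n \<ge> 1" for j n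
  proof (cases "j < Suc n0")
    case True
    then have "norm (E j) \<le> C" unfolding C_def by (intro member_le_sum) auto
    then show ?thesis using \<gamma>(1)[OF j(2)] by (simp add: add_increasing2)
  next
    case False
    then have "norm (E j) < D * \<gamma> j" using n0[of j] by simp
    also have "\<dots> \<le> \<bar>D\<bar> * \<gamma> j" using False \<gamma>(1)[of j] by (intro mult_right_mono) auto
    also have "\<dots> \<le> \<bar>D\<bar> * \<gamma> n" using False j mono_onD[OF \<gamma>(2), of j n] by (intro mult_left_mono) auto
    finally show ?thesis using C by simp
  qed
  then show ?thesis by (rule that)
qed

text \<open>Everything after the almost sure statements is deterministic, so \<open>\<omega>\<close>
  and the trajectory \<open>y\<close> are fixed here.\<close>

lemma pathwise_consistency:
  fixes y :: "nat \<Rightarrow> real^'p" and B :: "real \<Rightarrow> 'b \<Rightarrow> real^'p" and L :: "real^'p^'p"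
  assumes b: "batch_size_condition b"
    and \<gamma>: "\<And>n. n \<ge> 1 \<Longrightarrow> 0 \<le> \<gamma> n" "mono_on {1..} \<gamma>"
    and ratio: "(\<lambda>n. \<gamma> n / sqrt (real (b n))) \<longlonglongrightarrow> 0"
    and sip: "\<forall>\<^sub>F n in sequentially. norm (real n *\<^sub>R (sample_mean y n - \<theta>) - L *v B (real n) \<omega>) < D * \<gamma> n"
    and cov: "\<And>i j. (\<lambda>n. (\<Sum>k<n div b n. increment B (b n) k \<omega> $ i * increment B (b n) k \<omega> $ j / real (b n))
            / real (n div b n)) \<longlonglongrightarrow> (if i = j then 1 else 0)"
    and negl: "\<And>i. (\<lambda>n. sqrt (real (b n)) / real n * B (real n) \<omega> $ i) \<longlonglongrightarrow> 0"
  shows "(\<lambda>n. batch_means_estimator b y n) \<longlonglongrightarrow> L ** transpose L"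
proof -
  define E where "E n = real n *\<^sub>R (sample_mean y n - \<theta>) - L *v B (real n) \<omega>" for n
  obtain C where C: "\<And>j n. j \<le> n \<Longrightarrow> n \<ge> 1 \<Longrightarrow> norm (E j) \<le> C + \<bar>D\<bar> * \<gamma> n"
    using extend_eventual_bound[OF sip[folded E_def] \<gamma>] by blast
  \<comment> \<open>\<open>e\<close> is the scaled approximation error, \<open>v\<close> the
    Brownian part of the overall mean, and \<open>\<rho>\<close> their total effect on a batch.
    \<open>r\<close> is the normalised batch deviation that enters the estimator, \<open>x\<close>
    its Brownian counterpart.\<close>
  define e where "e n = (C + \<bar>D\<bar> * \<gamma> n) / sqrt (real (b n))" for n
  define v where "v n = (sqrt (real (b n)) / real n) *\<^sub>R B (real n) \<omega>" for n
  define \<rho> where "\<rho> n = 2 * e n + real (b n) / real n * e n + norm (L *v v n)" for n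
  define r where "r n k = sqrt (real (b n)) *\<^sub>R (batch_mean y (b n) k - sample_mean y n)" for n k
  define x where "x n k = L *v ((1 / sqrt (real (b n))) *\<^sub>R increment B (b n) k \<omega>)" for n k
  have b_top: "filterlim (\<lambda>n. real (b n)) at_top sequentially"
    using b by (auto simp: batch_size_condition_def filterlim_sequentially_iff_filterlim_real)
  have "filterlim (\<lambda>n. real n / real (b n)) at_top sequentially"
    using b by (simp add: batch_size_condition_def)
  from tendsto_inverse_0_at_top[OF this] have b_n: "(\<lambda>n. real (b n) / real n) \<longlonglongrightarrow> 0" by simp
  have "(\<lambda>n. C * inverse (sqrt (real (b n))) + \<bar>D\<bar> * (\<gamma> n / sqrt (real (b n)))) \<longlonglongrightarrow> C * 0 + \<bar>D\<bar> * 0"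
    by (intro tendsto_intros ratio tendsto_inverse_0_at_top filterlim_compose[OF sqrt_at_top b_top])
  then have e: "e \<longlonglongrightarrow> 0"
    by (simp add: e_def[abs_def] field_simps add_divide_distrib)
  have "v \<longlonglongrightarrow> 0"
    by (rule vec_tendstoI) (simp only: v_def vector_scaleR_component real_scaleR_def zero_index negl)
  then have "(\<lambda>n. L *v v n) \<longlonglongrightarrow> L *v 0"
    by (rule bounded_linear.tendsto[OF matrix_vector_mul_bounded_linear])
  then have Lv: "(\<lambda>n. norm (L *v v n)) \<longlonglongrightarrow> 0"
    by (simp add: tendsto_norm_zero)
  have "\<rho> \<longlonglongrightarrow> 2 * 0 + 0 * 0 + 0"
    unfolding \<rho>_def[abs_def] by (intro tendsto_intros e b_n Lv)
  then have \<rho>: "\<rho> \<longlonglongrightarrow> 0" by simp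
  have close: "\<forall>\<^sub>F n in sequentially. \<forall>k<n div b n. norm (r n k - x n k) \<le> \<rho> n"
    using batch_size_eventually_pos[OF b] eventually_gt_at_top[of 0]
  proof eventually_elim
    case (elim n)
    show ?case
    proof (intro allI impI)
      fix k assume k: "k < n div b n"
      let ?m = "b n" and ?q = "sqrt (real (b n))"
      have q: "?q > 0" "?q * ?q = real ?m" using elim by auto
      \<comment> \<open>Only complete batches are used, so both endpoints are at most
        \<open>n\<close> and the uniform bound \<open>C\<close> covers their errors.\<close>
      have "Suc k * ?m \<le> n div ?m * ?m" using k by (intro mult_right_mono) auto
      then have le: "Suc k * ?m \<le> n" using div_times_less_eq_dividend[of n ?m] by (rule order_trans)
      then have le': "k * ?m \<le> n" by simp
      have batch: "real ?m *\<^sub>R (batch_mean y ?m k - \<theta>)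
          = E (Suc k * ?m) - E (k * ?m) + L *v increment B ?m k \<omega>"
        using elim unfolding scaleR_diff_right scaled_batch_mean[OF elim(1)]
        by (simp add: E_def increment_def matrix_vector_mult_diff_distrib algebra_simps)
      have mean: "real n *\<^sub>R (sample_mean y n - \<theta>) = E n + L *v B (real n) \<omega>"
        by (simp add: E_def)
      \<comment> \<open>Centring both means at \<open>\<theta>\<close> does not change their
        difference, and \<open>?q\<close> equals \<open>?m / ?q\<close>.\<close>
      have "r n k = (1 / ?q) *\<^sub>R (real ?m *\<^sub>R (batch_mean y ?m k - \<theta>))
          - (?q / real n) *\<^sub>R (real n *\<^sub>R (sample_mean y n - \<theta>))"
        using elim by (simp add: r_def real_div_sqrt algebra_simps)
      also have "\<dots> - x n k = (1 / ?q) *\<^sub>R (E (Suc k * ?m) - E (k * ?m)) - (?q / real n) *\<^sub>R E n - L *v v n"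
        unfolding batch mean by (simp add: x_def v_def matrix_vector_mult_scaleR algebra_simps)
      finally have eq: "r n k - x n k
          = (1 / ?q) *\<^sub>R (E (Suc k * ?m) - E (k * ?m)) - (?q / real n) *\<^sub>R E n - L *v v n" .
      have "norm ((1 / ?q) *\<^sub>R (E (Suc k * ?m) - E (k * ?m))) \<le> (1 / ?q) * (2 * (C + \<bar>D\<bar> * \<gamma> n))"
        using C[OF le] C[OF le'] elim q norm_triangle_ineq4[of "E (Suc k * ?m)" "E (k * ?m)"]
        unfolding norm_scaleR by (intro mult_mono) auto
      also have "\<dots> = 2 * e n" by (simp add: e_def)
      finally have 1: "norm ((1 / ?q) *\<^sub>R (E (Suc k * ?m) - E (k * ?m))) \<le> 2 * e n" .
      have "norm ((?q / real n) *\<^sub>R E n) \<le> (?q / real n) * (C + \<bar>D\<bar> * \<gamma> n)"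
        using C[of n n] elim unfolding norm_scaleR by (intro mult_mono) auto
      also have "\<dots> = real (b n) / real n * e n"
      proof -
        have "s / real n * K = s * s / real n * (K / s)" if "s > 0" for s K using that by simp
        from this[OF q(1)] show ?thesis unfolding q(2) e_def .
      qed
      finally have 2: "norm ((?q / real n) *\<^sub>R E n) \<le> real (b n) / real n * e n" .
      show "norm (r n k - x n k) \<le> \<rho> n"
        unfolding eq \<rho>_def
        by (intro order_trans[OF norm_triangle_ineq4] add_mono 1 2 order_refl)
    qed
  qed
  have comp: "\<forall>\<^sub>F n in sequentially. \<forall>k<n div b n. \<bar>r n k $ i - x n k $ i\<bar> \<le> \<rho> n" for i
    using close by eventually_elim (metis component_le_norm_cart order_trans vector_minus_component)
  \<comment> \<open>By bilinearity the averages for \<open>x\<close> are finite combinations of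
    those in \<open>cov\<close>; the identity limit collapses the double sum to an entry of
    \<open>L ** transpose L\<close>.\<close>
  have xx: "(\<lambda>n. (\<Sum>k<n div b n. x n k $ i * x n k $ j) / real (n div b n)) \<longlonglongrightarrow> (L ** transpose L) $ i $ j" for i j
  proof -
    have "(\<lambda>n. \<Sum>l\<in>UNIV. \<Sum>l'\<in>UNIV. L $ i $ l * L $ j $ l' *
        ((\<Sum>k<n div b n. increment B (b n) k \<omega> $ l * increment B (b n) k \<omega> $ l' / real (b n)) / real (n div b n)))
      \<longlonglongrightarrow> (\<Sum>l\<in>UNIV. \<Sum>l'\<in>UNIV. L $ i $ l * L $ j $ l' * (if l = l' then 1 else 0))"
      by (intro tendsto_intros cov)
    also have "(\<Sum>l\<in>UNIV. \<Sum>l'\<in>UNIV. L $ i $ l * L $ j $ l' * (if l = l' then 1 else 0)) = (L ** transpose L) $ i $ j"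
      by (simp add: matrix_matrix_mult_def transpose_def if_distrib[of "(*) _"] cong: if_cong)
    finally show ?thesis
    proof (rule Lim_transform_eventually)
      have expand: "x n k $ i * x n k $ j = (\<Sum>l\<in>UNIV. \<Sum>l'\<in>UNIV. L $ i $ l * L $ j $ l' *
          (increment B (b n) k \<omega> $ l * increment B (b n) k \<omega> $ l' / real (b n)))" for n k
      proof -
        have "x n k $ i * x n k $ j = (L *v increment B (b n) k \<omega>) $ i * (L *v increment B (b n) k \<omega>) $ j / real (b n)"
          by (simp add: x_def matrix_vector_mult_scaleR)
        also have "\<dots> = (\<Sum>l\<in>UNIV. \<Sum>l'\<in>UNIV. (L $ i $ l * increment B (b n) k \<omega> $ l) *
            (L $ j $ l' * increment B (b n) k \<omega> $ l')) / real (b n)"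
          by (simp add: matrix_vector_mult_def sum_product)
        finally show ?thesis by (simp add: sum_divide_distrib mult_ac)
      qed
      show "\<forall>\<^sub>F n in sequentially. (\<Sum>l\<in>UNIV. \<Sum>l'\<in>UNIV. L $ i $ l * L $ j $ l' *
        ((\<Sum>k<n div b n. increment B (b n) k \<omega> $ l * increment B (b n) k \<omega> $ l' / real (b n)) / real (n div b n)))
        = (\<Sum>k<n div b n. x n k $ i * x n k $ j) / real (n div b n)"
      proof (intro always_eventually allI)
        fix n
        let ?t = "\<lambda>k l l'. L $ i $ l * L $ j $ l' *
          (increment B (b n) k \<omega> $ l * increment B (b n) k \<omega> $ l' / real (b n))"
        have "(\<Sum>k<n div b n. x n k $ i * x n k $ j) = (\<Sum>l\<in>UNIV. \<Sum>k<n div b n. \<Sum>l'\<in>UNIV. ?t k l l')"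
          unfolding expand by (rule sum.swap)
        also have "\<dots> = (\<Sum>l\<in>UNIV. \<Sum>l'\<in>UNIV. \<Sum>k<n div b n. ?t k l l')"
          by (intro sum.cong refl sum.swap)
        finally show "(\<Sum>l\<in>UNIV. \<Sum>l'\<in>UNIV. L $ i $ l * L $ j $ l' *
          ((\<Sum>k<n div b n. increment B (b n) k \<omega> $ l * increment B (b n) k \<omega> $ l' / real (b n)) / real (n div b n)))
          = (\<Sum>k<n div b n. x n k $ i * x n k $ j) / real (n div b n)"
          by (simp only: sum_distrib_left[symmetric] sum_divide_distrib[symmetric] times_divide_eq_right)
      qed
    qed
  qed
  have "(\<lambda>n. batch_means_estimator b y n $ i $ j) \<longlonglongrightarrow> (L ** transpose L) $ i $ j" for i j
  proof -
    \<comment> \<open>The diagonal instances of \<open>xx\<close> supply the convergent averages of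
      squares.\<close>
    have "(\<lambda>n. (\<Sum>k<n div b n. r n k $ i * r n k $ j) / (real (n div b n) - 1)) \<longlonglongrightarrow> (L ** transpose L) $ i $ j"
      by (rule perturbed_products_tendsto[OF filterlim_batch_count[OF b] xx xx xx comp comp \<rho>])
    moreover have "batch_means_estimator b y n $ i $ j
        = (\<Sum>k<n div b n. r n k $ i * r n k $ j) / (real (n div b n) - 1)" for n
    proof -
      have "r n k $ i * r n k $ j = real (b n) * ((batch_mean y (b n) k - sample_mean y n) $ i
          * (batch_mean y (b n) k - sample_mean y n) $ j)" for k
      proof -
        have "(s * u) * (s * w) = (s * s) * (u * w)" for s u w :: real by simp
        then show ?thesis
          unfolding r_def vector_scaleR_component real_scaleR_def by (simp only: real_sqrt_mult_self abs_of_nat)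
      qed
      then show ?thesis
        by (simp add: batch_means_estimator_component sum_distrib_left[symmetric])
    qed
    ultimately show ?thesis by simp
  qed
  then show ?thesis by (intro vec_tendstoI) auto
qed

section \<open>Transfer between processes with the same law\<close>

text \<open>Measurability follows once convergence is written with quantifiers over natural numbers
  and thresholds \<open>1 / real (Suc m)\<close>.\<close>

lemma pred_tendsto_real:
  fixes f :: "nat \<Rightarrow> 'a \<Rightarrow> real"
  assumes [measurable]: "\<And>n. f n \<in> borel_measurable M"
  shows "Measurable.pred M (\<lambda>x. (\<lambda>n. f n x) \<longlonglongrightarrow> c)"
proof -
  have "(\<lambda>n. f n x) \<longlonglongrightarrow> c \<longleftrightarrow> (\<forall>m. \<exists>k. \<forall>n. k \<le> n \<longrightarrow> \<bar>f n x - c\<bar> < 1 / real (Suc m))" for x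
  proof
    assume *: "(\<lambda>n. f n x) \<longlonglongrightarrow> c"
    show "\<forall>m. \<exists>k. \<forall>n. k \<le> n \<longrightarrow> \<bar>f n x - c\<bar> < 1 / real (Suc m)"
    proof
      fix m show "\<exists>k. \<forall>n. k \<le> n \<longrightarrow> \<bar>f n x - c\<bar> < 1 / real (Suc m)"
        using LIMSEQ_D[OF *, of "1 / real (Suc m)"] by auto
    qed
  next
    assume *: "\<forall>m. \<exists>k. \<forall>n. k \<le> n \<longrightarrow> \<bar>f n x - c\<bar> < 1 / real (Suc m)"
    show "(\<lambda>n. f n x) \<longlonglongrightarrow> c"
    proof (rule LIMSEQ_I)
      fix r :: real assume "r > 0"
      then obtain m where m: "1 / real (Suc m) < r" using nat_approx_posE by blast
      with *[rule_format, of m] show "\<exists>k. \<forall>n\<ge>k. norm (f n x - c) < r"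
        by (metis less_trans real_norm_def)
    qed
  qed
  then show ?thesis by simp
qed

lemma estimator_converges_measurable:
  "Measurable.pred (\<Pi>\<^sub>M t\<in>{1..}. borel) (\<lambda>z. (\<lambda>n. batch_means_estimator b (z :: nat \<Rightarrow> real^'p) n) \<longlonglongrightarrow> S)"
proof -
  let ?P = "\<Pi>\<^sub>M t\<in>{1::nat..}. (borel :: (real^'p) measure)"
  have [measurable]: "(\<lambda>z. z t) \<in> borel_measurable ?P" if "t \<ge> 1" for t
    using that by simp
  have [measurable]: "(\<lambda>z. sample_mean z n) \<in> borel_measurable ?P" for n
    unfolding sample_mean_def by (intro borel_measurable_scaleR borel_measurable_sum) auto
  have [measurable]: "(\<lambda>z. batch_mean z m k) \<in> borel_measurable ?P" for m k
    unfolding batch_mean_def by (intro borel_measurable_scaleR borel_measurable_sum) auto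
  have estimator: "(\<lambda>z. batch_means_estimator b z n $ i $ j) \<in> borel_measurable ?P" for n i j
    unfolding batch_means_estimator_component by measurable
  have "(\<lambda>n. batch_means_estimator b z n) \<longlonglongrightarrow> S
      \<longleftrightarrow> (\<forall>i j. (\<lambda>n. batch_means_estimator b z n $ i $ j) \<longlonglongrightarrow> S $ i $ j)" for z :: "nat \<Rightarrow> real^'p"
    by (auto intro: vec_tendstoI tendsto_vec_nth)
  moreover have "Measurable.pred ?P (\<lambda>z. \<forall>i j. (\<lambda>n. batch_means_estimator b z n $ i $ j) \<longlonglongrightarrow> S $ i $ j)"
    by (intro pred_intros_countable pred_tendsto_real estimator)
  ultimately show ?thesis by simp
qed

text \<open>All sums in the estimator start at index \<open>1\<close> or later, so the undefined
  value of the restricted trajectory at \<open>0\<close> never enters.\<close>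

lemma batch_means_estimator_restrict:
  "batch_means_estimator b (\<lambda>t\<in>{1..}. y t) = batch_means_estimator b y"
proof
  fix n
  have "sample_mean (\<lambda>t\<in>{1..}. y t) n = sample_mean y n"
    unfolding sample_mean_def by (intro arg_cong2[where f = scaleR] sum.cong) auto
  moreover have "batch_mean (\<lambda>t\<in>{1..}. y t) m k = batch_mean y m k" for m k
    unfolding batch_mean_def by (intro arg_cong2[where f = scaleR] sum.cong) auto
  ultimately show "batch_means_estimator b (\<lambda>t\<in>{1..}. y t) n = batch_means_estimator b y n"
    by (simp only: batch_means_estimator_def)
qed

text \<open>The convergence set is measurable in the trajectory space, so its probability can be
  computed under the law. This links the two probability spaces.\<close>

lemma AE_process_law_iff:
  assumes "\<And>t. t \<ge> 1 \<Longrightarrow> Y t \<in> borel_measurable M"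
  shows "(AE z in process_law M Y. (\<lambda>n. batch_means_estimator b z n) \<longlonglongrightarrow> S)
    \<longleftrightarrow> (AE \<omega> in M. (\<lambda>n. batch_means_estimator b (\<lambda>t. Y t \<omega>) n) \<longlonglongrightarrow> S)"
proof -
  have "(\<lambda>\<omega>. \<lambda>t\<in>{1..}. Y t \<omega>) \<in> M \<rightarrow>\<^sub>M (\<Pi>\<^sub>M t\<in>{1..}. borel)"
    using assms by (intro measurable_restrict) auto
  moreover have "{z \<in> space (\<Pi>\<^sub>M t\<in>{1..}. borel). (\<lambda>n. batch_means_estimator b z n) \<longlonglongrightarrow> S}
      \<in> sets (\<Pi>\<^sub>M t\<in>{1..}. borel)"
    using estimator_converges_measurable by (rule predE)
  ultimately show ?thesis
    unfolding process_law_def by (subst AE_distr_iff) (simp_all only: batch_means_estimator_restrict)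
qed

section \<open>Almost sure convergence on the original probability space\<close>

theorem theorem4:
  fixes M :: "'a measure" and N :: "'b measure"
    and Y :: "nat \<Rightarrow> 'a \<Rightarrow> real^'p::{finite,linorder}"
    and Y' :: "nat \<Rightarrow> 'b \<Rightarrow> real^'p::{finite,linorder}"
    and \<theta> :: "real^'p::{finite,linorder}"
    and L :: "real^'p::{finite,linorder}^'p::{finite,linorder}"
    and \<gamma> :: "nat \<Rightarrow> real"
    and B :: "real \<Rightarrow> 'b \<Rightarrow> real^'p::{finite,linorder}" and D :: "'b \<Rightarrow> real"
    and b :: "nat \<Rightarrow> nat"
  assumes "prob_space M" and "\<And>t. t \<ge> 1 \<Longrightarrow> Y t \<in> borel_measurable M"
    and "prob_space N" and "\<And>t. t \<ge> 1 \<Longrightarrow> Y' t \<in> borel_measurable N"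
    and "process_law N Y' = process_law M Y"
    and "standard_brownian_motion N B"
    and "D \<in> borel_measurable N"
    and "lower_triangular L"
    and "\<And>n. n \<ge> 1 \<Longrightarrow> 0 \<le> \<gamma> n" and "mono_on {1..} \<gamma>"
    and "AE \<omega> in N. \<forall>\<^sub>F n in sequentially.
           norm (real n *\<^sub>R (sample_mean (\<lambda>t. Y' t \<omega>) n - \<theta>) - L *v B (real n) \<omega>) < D \<omega> * \<gamma> n"
    and "batch_size_condition b"
    and "(\<lambda>n. real (b n) powr (- 1 / 2) * ln (real n) powr (1 / 2) * \<gamma> n) \<longlonglongrightarrow> 0"
  shows "AE \<omega> in M. (\<lambda>n. batch_means_estimator b (\<lambda>t. Y t \<omega>) n) \<longlonglongrightarrow> L ** transpose L"
proof -
  have ratio: "(\<lambda>n. \<gamma> n / sqrt (real (b n))) \<longlonglongrightarrow> 0"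
  proof (rule Lim_null_comparison)
    show "\<forall>\<^sub>F n in sequentially. norm (\<gamma> n / sqrt (real (b n)))
        \<le> real (b n) powr (- 1 / 2) * ln (real n) powr (1 / 2) * \<gamma> n"
      \<comment> \<open>From \<open>n = 3\<close> on the logarithm is at least \<open>1\<close>,
        because \<open>exp 1 \<le> 3\<close>; the logarithmic factor then only enlarges the
        bound.\<close>
      using eventually_ge_at_top[of 3]
    proof eventually_elim
      case (elim n)
      have "1 \<le> ln (real n)" using elim exp_le by (subst ln_ge_iff) auto
      then have "1 \<le> ln (real n) powr (1 / 2)" by (simp add: ge_one_powr_ge_zero)
      moreover have \<gamma>0: "0 \<le> \<gamma> n" using assms(9)[of n] elim by simp
      ultimately have "\<gamma> n * inverse (sqrt (real (b n))) * 1
          \<le> \<gamma> n * inverse (sqrt (real (b n))) * ln (real n) powr (1 / 2)"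
        by (intro mult_left_mono) auto
      moreover have "real (b n) powr (- 1 / 2) = inverse (sqrt (real (b n)))"
        unfolding minus_divide_left[symmetric] by (simp only: powr_minus powr_half_sqrt of_nat_0_le_iff)
      moreover have "norm (\<gamma> n / sqrt (real (b n))) = \<gamma> n * inverse (sqrt (real (b n))) * 1"
        using \<gamma>0 by (simp add: abs_divide divide_inverse)
      ultimately show ?case by (simp only: mult_ac)
    qed
  qed (fact assms(13))
  have "AE \<omega> in N. \<forall>i j. (\<lambda>n. (\<Sum>k<n div b n. increment B (b n) k \<omega> $ i * increment B (b n) k \<omega> $ j / real (b n))
            / real (n div b n)) \<longlonglongrightarrow> (if i = j then 1 else 0)"
    unfolding AE_all_countable by (intro allI AE_batch_covariance[OF assms(6,12)])
  moreover have "AE \<omega> in N. \<forall>i. (\<lambda>n. sqrt (real (b n)) / real n * B (real n) \<omega> $ i) \<longlonglongrightarrow> 0"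
    unfolding AE_all_countable by (intro allI AE_brownian_negligible[OF assms(6,12)])
  ultimately have "AE \<omega> in N. (\<lambda>n. batch_means_estimator b (\<lambda>t. Y' t \<omega>) n) \<longlonglongrightarrow> L ** transpose L"
    using assms(11)
  proof eventually_elim
    case (elim \<omega>)
    show ?case
      by (rule pathwise_consistency[where B = B and \<omega> = \<omega> and y = "\<lambda>t. Y' t \<omega>", OF assms(12,9,10) ratio elim(3)]) (simp_all only: elim(1,2))
  qed
  \<comment> \<open>The conclusion travels from \<open>Y'\<close> to the common law and from there
    to \<open>Y\<close>.\<close>
  then have "AE z in process_law N Y'. (\<lambda>n. batch_means_estimator b z n) \<longlonglongrightarrow> L ** transpose L"
    using AE_process_law_iff[of Y' N b "L ** transpose L"] assms(4) by simp
  then show ?thesis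
    using AE_process_law_iff[of Y M b "L ** transpose L"] assms(2) unfolding assms(5) by simp
qed

end
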